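(* Let $K$ be a field of characteristic $0$. For every $n\ge 2$, $$L_n\cap \sigma S_{n-2}=0,$$ where $\sigma=t_1+\cdots+t_n$, $S_{n-2}$ is the space of homogeneous polynomials of degree $n-2$ in $K[t_1,\ldots,t_n]$, and $L_n$ is the space of symbols of multilinear Lie elements of degree $n$. In particular, a nonzero multilinear Lie element $f\in\mathrm{Nov}(n)$ of $\mathrm{Nov}\langle X\rangle$ is not a total derivative, i.e. it is not of the form $D(g)$ with $g\in K\{X\}$.
   Context: A Novikov algebra over $K$ is a (nonassociative) algebra $(N,\circ)$ satisfying $(a\circ b)\circ c-a\circ(b\circ c)=(b\circ a)\circ c-b\circ(a\circ c)$ and $(a\circ b)\circ c=(a\circ c)\circ b$. Its commutator $[a,b]=a\circ b-b\circ a$ satisfies the Jacobi identity; the resulting Lie algebra is denoted $N^{(-)}$. Let $X=\{x_1,\ldots,x_n\}$ and let $K\{X\}=K[x_i^{(r)}\mid 1\le i\le n,\ r\ge 0]$ be the free commutative differential algebra, with $x_i=x_i^{(0)}$ and derivation $D$ given by $D(x_i^{(r)})=x_i^{(r+1)}$. With the product $f\circ g=f\,D(g)$ it is a Novikov algebra, and (Dzhumadil'daev–Löfwall) the subalgebra of $(K\{X\},\circ)$ generated by $X$ is the free Novikov algebra $\mathrm{Nov}\langle X\rangle$ on $X$; we identify the two. $\mathrm{Nov}(n)$ denotes the multilinear component of $\mathrm{Nov}\langle X\rangle$ in $x_1,\ldots,x_n$; it has as basis the differential monomials $x_1^{(\alpha_1)}\cdots x_n^{(\alpha_n)}$ with $\alpha\in\mathbb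 Z_{\ge0}^n$, $\alpha_1+\cdots+\alpha_n=n-1$. The symbol $P_f$ of $f\in\mathrm{Nov}(n)$ is its image under the linear isomorphism $x_1^{(\alpha_1)}\cdots x_n^{(\alpha_n)}\mapsto t_1^{\alpha_1}\cdots t_n^{\alpha_n}$ from $\mathrm{Nov}(n)$ onto the space $S_{n-1}$ of homogeneous polynomials of degree $n-1$ in $K[t_1,\ldots,t_n]$. An element of $\mathrm{Nov}\langle X\rangle$ is a Lie element if it belongs to the Lie subalgebra of $\mathrm{Nov}\langle X\rangle^{(-)}$ generated by $X$. Put $L_n=\{P_f\mid f\in\mathrm{Nov}(n)\text{ is a Lie element}\}\subseteq S_{n-1}$. *)

theory Defs
  imports Complex_Main "HOL-Library.Poly_Mapping"
begin

subsection \<open>The free commutative differential algebra\<close>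

text \<open>
  A polynomial with coefficients in \<open>'k\<close> is a finitely supported map from exponent vectors to
  \<open>'k\<close>; its product is the convolution product of \<^theory>\<open>HOL-Library.Poly_Mapping\<close>.  The index
  \<open>(i, r)\<close> stands for the variable \<open>x\<^sub>i\<^sup>(\<^sup>r\<^sup>)\<close>.  The types \<open>'k dpoly\<close> and \<open>'k mpoly\<close> have variables for all
  \<open>i :: nat\<close>; the restriction to \<open>1 \<le> i \<le> n\<close> is made by the sets \<open>diff_alg n\<close> and
  \<open>homogeneous n d\<close>.
\<close>

type_synonym 'k dpoly = "((nat \<times> nat) \<Rightarrow>\<^sub>0 nat) \<Rightarrow>\<^sub>0 'k"
type_synonym 'k mpoly = "(nat \<Rightarrow>\<^sub>0 nat) \<Rightarrow>\<^sub>0 'k"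

definition dvar :: "nat \<Rightarrow> nat \<Rightarrow> 'k::field dpoly" where
  "dvar i r = Poly_Mapping.single (Poly_Mapping.single (i, r) 1) 1"

definition scale :: "'k::field \<Rightarrow> 'k dpoly \<Rightarrow> 'k dpoly" where
  "scale c f = Poly_Mapping.single 0 c * f"

definition diff_alg :: "nat \<Rightarrow> 'k::field dpoly set" where
  "diff_alg n = {f. \<forall>m \<in> Poly_Mapping.keys f. Poly_Mapping.keys m \<subseteq> {1..n} \<times> UNIV}"

text \<open>
  On a monomial, \<open>D\<close> is given by the Leibniz rule: every variable \<open>x\<^sub>i\<^sup>(\<^sup>r\<^sup>)\<close> of the monomial \<open>m\<close>, of
  exponent \<open>e\<close>, contributes \<open>e\<close> times \<open>m\<close> with one factor \<open>x\<^sub>i\<^sup>(\<^sup>r\<^sup>)\<close> replaced by \<open>x\<^sub>i\<^sup>(\<^sup>r\<^sup>+\<^sup>1\<^sup>)\<close>.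
  The lemmas \<open>D_add\<close>, \<open>D_scale\<close>, \<open>D_mult\<close> and \<open>D_dvar\<close> below show that \<open>D\<close> is the derivation with
  \<open>D (dvar i r) = dvar i (Suc r)\<close>.
\<close>

definition D_monom :: "((nat \<times> nat) \<Rightarrow>\<^sub>0 nat) \<Rightarrow> 'k::field dpoly" where
  "D_monom m = (\<Sum>(i, r) \<in> Poly_Mapping.keys m.
     Poly_Mapping.single
       (m - Poly_Mapping.single (i, r) 1 + Poly_Mapping.single (i, Suc r) 1)
       (of_nat (Poly_Mapping.lookup m (i, r))))"

definition D :: "'k::field dpoly \<Rightarrow> 'k dpoly" where
  "D f = (\<Sum>m \<in> Poly_Mapping.keys f. scale (Poly_Mapping.lookup f m) (D_monom m))"


subsection \<open>Novikov and Lie elements\<close>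

definition nov_prod :: "'k::field dpoly \<Rightarrow> 'k dpoly \<Rightarrow> 'k dpoly" where
  "nov_prod f g = f * D g"

definition nov_comm :: "'k::field dpoly \<Rightarrow> 'k dpoly \<Rightarrow> 'k dpoly" where
  "nov_comm f g = nov_prod f g - nov_prod g f"

inductive_set gen_subalgebra ::
    "('k::field dpoly \<Rightarrow> 'k dpoly \<Rightarrow> 'k dpoly) \<Rightarrow> 'k dpoly set \<Rightarrow> 'k dpoly set"
  for mul :: "'k::field dpoly \<Rightarrow> 'k dpoly \<Rightarrow> 'k dpoly" and X :: "'k dpoly set" where
  gen: "f \<in> X \<Longrightarrow> f \<in> gen_subalgebra mul X"
| zero: "0 \<in> gen_subalgebra mul X"
| add: "f \<in> gen_subalgebra mul X \<Longrightarrow> g \<in> gen_subalgebra mul X \<Longrightarrow> f + g \<in> gen_subalgebra mul X"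
| scale: "f \<in> gen_subalgebra mul X \<Longrightarrow> scale c f \<in> gen_subalgebra mul X"
| mul: "f \<in> gen_subalgebra mul X \<Longrightarrow> g \<in> gen_subalgebra mul X \<Longrightarrow> mul f g \<in> gen_subalgebra mul X"

definition gens :: "nat \<Rightarrow> 'k::field dpoly set" where
  "gens n = (\<lambda>i. dvar i 0) ` {1..n}"

definition free_Novikov :: "nat \<Rightarrow> 'k::field dpoly set" where
  "free_Novikov n = gen_subalgebra nov_prod (gens n)"

definition Lie_elements :: "nat \<Rightarrow> 'k::field dpoly set" where
  "Lie_elements n = gen_subalgebra nov_comm (gens n)"

text \<open>Multilinear: every monomial has total degree one in the variables \<open>x\<^sub>i\<^sup>(\<^sup>r\<^sup>)\<close>, \<open>r \<ge> 0\<close>, for each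
  \<open>i \<in> {1..n}\<close>.\<close>

definition multilinear :: "nat \<Rightarrow> 'k::field dpoly \<Rightarrow> bool" where
  "multilinear n f \<longleftrightarrow> (\<forall>m \<in> Poly_Mapping.keys f. \<forall>i \<in> {1..n}.
     (\<Sum>v \<in> {v \<in> Poly_Mapping.keys m. fst v = i}. Poly_Mapping.lookup m v) = 1)"

definition Nov :: "nat \<Rightarrow> 'k::field dpoly set" where
  "Nov n = {f \<in> free_Novikov n. multilinear n f}"


subsection \<open>Symbols\<close>

definition exponents :: "nat \<Rightarrow> nat \<Rightarrow> (nat \<Rightarrow>\<^sub>0 nat) set" where
  "exponents n d = {\<alpha>. Poly_Mapping.keys \<alpha> \<subseteq> {1..n} \<and> (\<Sum>i = 1..n. Poly_Mapping.lookup \<alpha> i) = d}"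

definition homogeneous :: "nat \<Rightarrow> nat \<Rightarrow> 'k::field mpoly set" where
  "homogeneous n d = {p. Poly_Mapping.keys p \<subseteq> exponents n d}"

definition tvar :: "nat \<Rightarrow> 'k::field mpoly" where
  "tvar i = Poly_Mapping.single (Poly_Mapping.single i 1) 1"

definition sigma :: "nat \<Rightarrow> 'k::field mpoly" where
  "sigma n = (\<Sum>i = 1..n. tvar i)"

text \<open>The exponent vector of the differential monomial \<open>x\<^sub>1\<^sup>(\<^sup>\<alpha>\<^sup>1\<^sup>) \<cdots> x\<^sub>n\<^sup>(\<^sup>\<alpha>\<^sup>n\<^sup>)\<close>.\<close>

definition dmonom :: "nat \<Rightarrow> (nat \<Rightarrow>\<^sub>0 nat) \<Rightarrow> ((nat \<times> nat) \<Rightarrow>\<^sub>0 nat)" where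
  "dmonom n \<alpha> = (\<Sum>i = 1..n. Poly_Mapping.single (i, Poly_Mapping.lookup \<alpha> i) 1)"

text \<open>
  The linear map sending \<open>x\<^sub>1\<^sup>(\<^sup>\<alpha>\<^sup>1\<^sup>) \<cdots> x\<^sub>n\<^sup>(\<^sup>\<alpha>\<^sup>n\<^sup>)\<close> to \<open>t\<^sup>\<alpha>\<close> for \<open>\<alpha>\<^sub>1 + \<cdots> + \<alpha>\<^sub>n = n - 1\<close>.  It is meaningful on
  \<open>Nov n\<close> only; all other differential monomials are sent to \<open>0\<close>.  The sum is over a finite set
  by \<open>finite_exponents\<close>.
\<close>

definition poly_symbol :: "nat \<Rightarrow> 'k::field dpoly \<Rightarrow> 'k mpoly" where
  "poly_symbol n f = (\<Sum>\<alpha> \<in> exponents n (n - 1).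
     Poly_Mapping.single \<alpha> (Poly_Mapping.lookup f (dmonom n \<alpha>)))"

definition Lie_symbols :: "nat \<Rightarrow> 'k::field mpoly set" where
  "Lie_symbols n = poly_symbol n ` (Nov n \<inter> Lie_elements n)"


subsection \<open>Basic properties\<close>

lemma lookup_scale [simp]: "Poly_Mapping.lookup (scale c f) m = c * Poly_Mapping.lookup f m"
  unfolding scale_def mult_map_scale_conv_mult[symmetric] by (simp add: Poly_Mapping.map.rep_eq when_def)

lemma scale_simps [simp]: "scale 0 f = 0" "scale c 0 = 0" "scale 1 f = f"
  by (simp_all add: scale_def)

lemma scale_single: "scale c (Poly_Mapping.single m d) = Poly_Mapping.single m (c * d)"
  by (simp add: scale_def mult_single)

lemma dpoly_expand: "f = (\<Sum>m \<in> Poly_Mapping.keys f. Poly_Mapping.single m (Poly_Mapping.lookup f m))"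
proof (rule poly_mapping_eqI)
  fix k
  show "Poly_Mapping.lookup f k = Poly_Mapping.lookup
      (\<Sum>m \<in> Poly_Mapping.keys f. Poly_Mapping.single m (Poly_Mapping.lookup f m)) k"
    by (cases "k \<in> Poly_Mapping.keys f")
      (auto simp: lookup_sum lookup_single when_def in_keys_iff)
qed

lemma D_superset:
  assumes "finite A" "Poly_Mapping.keys f \<subseteq> A"
  shows "D f = (\<Sum>m \<in> A. scale (Poly_Mapping.lookup f m) (D_monom m))"
  unfolding D_def using assms by (intro sum.mono_neutral_left) (auto simp: in_keys_iff)

lemma D_add: "D (f + g) = D f + D g"
proof -
  let ?A = "Poly_Mapping.keys f \<union> Poly_Mapping.keys g"
  have "D (f + g) = (\<Sum>m \<in> ?A. scale (Poly_Mapping.lookup (f + g) m) (D_monom m))"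
    by (rule D_superset) (auto dest: keys_add[THEN subsetD])
  also have "\<dots> = D f + D g"
    by (subst (1 2) D_superset[where A = ?A])
      (auto simp: sum.distrib[symmetric] lookup_add scale_def single_add distrib_right)
  finally show ?thesis .
qed

lemma D_scale: "D (scale c f) = scale c (D f)"
proof -
  have "D (scale c f) = (\<Sum>m \<in> Poly_Mapping.keys f. scale (Poly_Mapping.lookup (scale c f) m) (D_monom m))"
    by (rule D_superset) (auto simp: in_keys_iff)
  then show ?thesis
    by (simp add: D_def scale_def sum_distrib_left mult_single mult.assoc[symmetric] lookup_scale[unfolded scale_def])
qed

lemma D_0 [simp]: "D 0 = 0"
  by (simp add: D_def)

lemma D_sum: "D (sum f A) = (\<Sum>a \<in> A. D (f a))"
  by (induction A rule: infinite_finite_induct) (auto simp: D_add)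

lemma D_single: "D (Poly_Mapping.single m c) = scale c (D_monom m)"
  by (cases "c = 0") (simp_all add: D_def)

lemma D_monom_superset:
  assumes "finite A" "Poly_Mapping.keys m \<subseteq> A"
  shows "D_monom m = (\<Sum>(i, r) \<in> A.
     Poly_Mapping.single
       (m - Poly_Mapping.single (i, r) 1 + Poly_Mapping.single (i, Suc r) 1)
       (of_nat (Poly_Mapping.lookup m (i, r))))"
  unfolding D_monom_def using assms by (intro sum.mono_neutral_left) (auto simp: in_keys_iff)

lemma shift_single:
  "Poly_Mapping.single (a + b - Poly_Mapping.single v 1 + w) (of_nat (Poly_Mapping.lookup a v) :: 'k::field)
   = Poly_Mapping.single (a - Poly_Mapping.single v 1 + w) (of_nat (Poly_Mapping.lookup a v)) *
     Poly_Mapping.single (b :: 'v \<Rightarrow>\<^sub>0 nat) 1"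
proof (cases "Poly_Mapping.lookup a v = 0")
  case False
  then have "a + b - Poly_Mapping.single v 1 + w = a - Poly_Mapping.single v 1 + w + b"
    by (intro poly_mapping_eqI) (auto simp: lookup_add lookup_minus lookup_single when_def)
  then show ?thesis by (simp add: mult_single)
qed simp

lemma D_monom_add:
  "D_monom (a + b) = D_monom a * Poly_Mapping.single b 1 + Poly_Mapping.single a 1 * D_monom b"
proof -
  let ?A = "Poly_Mapping.keys a \<union> Poly_Mapping.keys b"
  let ?s = "\<lambda>m c v. Poly_Mapping.single
       (m - Poly_Mapping.single v 1 + Poly_Mapping.single (fst v, Suc (snd v)) 1)
       (of_nat (Poly_Mapping.lookup c v)) :: 'a dpoly"
  have *: "D_monom m = (\<Sum>v \<in> ?A. ?s m m v)" if "Poly_Mapping.keys m \<subseteq> ?A" for m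
    using D_monom_superset[of ?A m] that by (simp add: case_prod_beta)
  have "D_monom (a + b) = (\<Sum>v \<in> ?A. ?s (a + b) (a + b) v)"
    by (intro *) (rule keys_add)
  also have "\<dots> = (\<Sum>v \<in> ?A. ?s (a + b) a v + ?s (b + a) b v)"
    by (simp add: lookup_add single_add add.commute)
  also have "\<dots> = (\<Sum>v \<in> ?A. ?s a a v * Poly_Mapping.single b 1 + ?s b b v * Poly_Mapping.single a 1)"
    by (intro sum.cong arg_cong2[where f = "(+)"] shift_single refl)
  finally show ?thesis
    by (simp add: *[of a] *[of b] sum.distrib sum_distrib_left sum_distrib_right mult.commute)
qed

lemma D_mult_single:
  "D (Poly_Mapping.single a c * Poly_Mapping.single b d) =
   D (Poly_Mapping.single a c) * Poly_Mapping.single b d + Poly_Mapping.single a c * D (Poly_Mapping.single b d)"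
proof -
  have c: "Poly_Mapping.single a c = scale c (Poly_Mapping.single a 1)" for a and c :: 'a
    by (simp add: scale_single)
  have s: "scale (c * d) f = scale c (scale d f)" for c d :: 'a and f
    by (simp add: scale_def mult_single mult.assoc[symmetric])
  have m: "scale c f * g = scale c (f * g)" "f * scale c g = scale c (f * g)" for c :: 'a and f g
    by (simp_all add: scale_def ac_simps)
  have p: "scale c (f + g) = scale c f + scale c g" for c :: 'a and f g
    by (simp add: scale_def distrib_left)
  have comm: "scale d (scale c f) = scale c (scale d f)" for f
    by (simp add: s[symmetric] mult.commute)
  show ?thesis
    unfolding mult_single D_single D_monom_add
    by (subst (1) c[of b d], subst (1) c[of a c]) (simp only: m p s comm)
qed

theorem D_mult: "D (f * g) = D f * g + f * D g"
proof -
  let ?F = "\<lambda>m. Poly_Mapping.single m (Poly_Mapping.lookup f m)"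
  let ?G = "\<lambda>m. Poly_Mapping.single m (Poly_Mapping.lookup g m)"
  let ?f = "sum ?F (Poly_Mapping.keys f)" and ?g = "sum ?G (Poly_Mapping.keys g)"
  have "D (?f * ?g) = D ?f * ?g + ?f * D ?g"
    by (simp only: sum_product D_sum D_mult_single sum.distrib)
  then show ?thesis by (simp only: dpoly_expand[symmetric])
qed

lemma D_dvar: "D (dvar i r) = dvar i (Suc r)"
  by (simp add: dvar_def D_single D_monom_def)

lemma finite_exponents: "finite (exponents n d)"
proof -
  let ?F = "{h. \<forall>i. (i \<in> {1..n} \<longrightarrow> h i \<in> {..d}) \<and> (i \<notin> {1..n} \<longrightarrow> h i = 0)} :: (nat \<Rightarrow> nat) set"
  have "finite ?F"
    by (rule finite_set_of_finite_funs) simp_all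
  moreover have "Poly_Mapping.lookup ` exponents n d \<subseteq> ?F"
  proof
    fix h
    assume "h \<in> Poly_Mapping.lookup ` exponents n d"
    then obtain \<alpha> where \<alpha>: "h = Poly_Mapping.lookup \<alpha>" "Poly_Mapping.keys \<alpha> \<subseteq> {1..n}"
      and sum: "(\<Sum>i = 1..n. h i) = d"
      by (auto simp: exponents_def)
    have "h i \<le> d" if "i \<in> {1..n}" for i
      using member_le_sum[of i "{1..n}" h] that sum by simp
    moreover have "h i = 0" if "i \<notin> {1..n}" for i
      using \<alpha> that by (metis in_keys_iff subsetD)
    ultimately show "h \<in> ?F" by simp
  qed
  ultimately have "finite (Poly_Mapping.lookup ` exponents n d)"
    by (rule rev_finite_subset)
  then show ?thesis
    by (rule finite_imageD) (auto intro: inj_onI poly_mapping_eqI)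
qed

lemma lookup_poly_symbol:
  "Poly_Mapping.lookup (poly_symbol n f) \<alpha> =
   (if \<alpha> \<in> exponents n (n - 1) then Poly_Mapping.lookup f (dmonom n \<alpha>) else 0)"
  by (auto simp: poly_symbol_def lookup_sum lookup_single when_def finite_exponents)

lemma lookup_dmonom:
  "Poly_Mapping.lookup (dmonom n \<alpha>) (i, r) = (if i \<in> {1..n} \<and> Poly_Mapping.lookup \<alpha> i = r then 1 else 0)"
proof -
  have "Poly_Mapping.lookup (dmonom n \<alpha>) (i, r) =
      (\<Sum>j = 1..n. if j = i then (if Poly_Mapping.lookup \<alpha> i = r then 1 else 0) else 0)"
    unfolding dmonom_def lookup_sum by (intro sum.cong) (auto simp: lookup_single when_def)
  then show ?thesis by simp
qed

lemma dmonom_inject: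
  assumes "\<alpha> \<in> exponents n d" "\<beta> \<in> exponents n e" "dmonom n \<alpha> = dmonom n \<beta>"
  shows "\<alpha> = \<beta>"
proof (rule poly_mapping_eqI)
  fix i
  show "Poly_Mapping.lookup \<alpha> i = Poly_Mapping.lookup \<beta> i"
  proof (cases "i \<in> {1..n}")
    case True
    then show ?thesis
      using lookup_dmonom[of n \<alpha> i "Poly_Mapping.lookup \<alpha> i"]
        lookup_dmonom[of n \<beta> i "Poly_Mapping.lookup \<alpha> i"] assms(3)
      by (metis zero_neq_one)
  next
    case False
    then have "i \<notin> Poly_Mapping.keys \<alpha>" "i \<notin> Poly_Mapping.keys \<beta>"
      using assms(1,2) by (auto simp: exponents_def)
    then show ?thesis by (metis in_keys_iff)
  qed
qed

lemma poly_symbol_dmonom: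
  assumes "\<alpha> \<in> exponents n (n - 1)"
  shows "poly_symbol n (Poly_Mapping.single (dmonom n \<alpha>) c) = Poly_Mapping.single \<alpha> c"
  using assms
  by (intro poly_mapping_eqI) (simp add: lookup_poly_symbol lookup_single when_def, metis dmonom_inject)

lemma Lie_elements_subset: "Lie_elements n \<subseteq> (free_Novikov n :: 'k::field dpoly set)"
proof
  fix f :: "'k dpoly"
  assume "f \<in> Lie_elements n"
  then show "f \<in> free_Novikov n"
    unfolding Lie_elements_def free_Novikov_def
  proof (induction rule: gen_subalgebra.induct)
    case (mul f g)
    have "nov_comm f g = nov_prod f g + scale (- 1) (nov_prod g f)"
      by (intro poly_mapping_eqI) (simp add: nov_comm_def lookup_add lookup_minus)
    then show ?case by (simp add: mul gen_subalgebra.intros)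
  qed (blast intro: gen_subalgebra.intros)+
qed

end

theory Submission
  imports Defs
begin

text \<open>
  Let \<open>v\<close> be a new variable (\<open>x\<^sub>0\<close> below) and let \<open>\<delta>\<close> be the derivation that commutes with \<open>D\<close> and
  sends \<open>x\<^sub>i\<close> to \<open>[v, x\<^sub>i]\<close>.  By the Jacobi identity \<open>\<delta> f = [v, f] = v D f - f D v\<close> for every Lie
  element \<open>f\<close>.  If \<open>f = D g\<close>, then \<open>v D f - f D v = D H\<close> with \<open>H = \<delta> g\<close>.  As \<open>v\<close> does not occur
  in \<open>f\<close>, comparing partial derivatives with respect to \<open>v\<^sup>(\<^sup>r\<^sup>)\<close> from large \<open>r\<close> downwards gives
  \<open>\<partial>H/\<partial>v = - f\<close> and then \<open>D (\<partial>H/\<partial>v) = D f\<close>, so \<open>2 D f = 0\<close> and \<open>f\<close> is constant, hence \<open>0\<close>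
  because Novikov elements have weight \<open>-1\<close>.  Finally, \<open>\<sigma> P\<close> is the symbol of the derivative of the
  element with symbol \<open>P\<close>.
\<close>

subsection \<open>Derivations of the polynomial algebra\<close>

definition derivation :: "('k::field dpoly \<Rightarrow> 'k dpoly) \<Rightarrow> bool" where
  "derivation d \<longleftrightarrow> (\<forall>f g. d (f + g) = d f + d g) \<and> (\<forall>f g. d (f * g) = d f * g + f * d g)
     \<and> (\<forall>c. d (Poly_Mapping.single 0 c) = 0)"

lemma derivation_add: "derivation d \<Longrightarrow> d (f + g) = d f + d g"
  and derivation_mult: "derivation d \<Longrightarrow> d (f * g) = d f * g + f * d g"
  and derivation_const: "derivation d \<Longrightarrow> d (Poly_Mapping.single 0 c) = 0"
  by (simp_all add: derivation_def)

lemma derivation_0: "derivation d \<Longrightarrow> d 0 = 0"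
  using derivation_const[of d 0] by simp

lemma derivation_scale: "derivation d \<Longrightarrow> d (scale c f) = scale c (d f)"
  by (simp add: scale_def derivation_mult derivation_const)

lemma derivation_minus: "derivation d \<Longrightarrow> d (f - g) = d f - d g"
  using derivation_add[of d "f - g" g] by (simp add: algebra_simps)

text \<open>The mixed terms \<open>d f * e g\<close> and \<open>e f * d g\<close> cancel.
  Commutation rules with \<open>D\<close> thus become identities between derivations, which can be
  checked on variables by \<open>derivation_eqI\<close>.\<close>

lemma derivation_commutator:
  assumes "derivation d" "derivation e"
  shows "derivation (\<lambda>f. d (e f) - e (d f))"
  using assms
  by (simp add: derivation_def derivation_0 algebra_simps)

lemma derivation_zero: "derivation (\<lambda>f. 0)"
  by (simp add: derivation_def)

lemma derivation_D: "derivation D"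
  by (simp add: derivation_def D_add D_mult D_single D_monom_def)

lemma D_1: "D 1 = 0"
  using derivation_const[OF derivation_D, of 1] by simp

text \<open>Constants and variables generate the algebra: the proof climbs from powers of one
  variable to monomials, to their scalar multiples, and to sums of these.\<close>

lemma dpoly_induct [case_names const dvar add mult]:
  assumes const: "\<And>c. P (Poly_Mapping.single 0 c)"
    and dvar: "\<And>i r. P (dvar i r)"
    and add: "\<And>f g. P f \<Longrightarrow> P g \<Longrightarrow> P (f + g)"
    and mult: "\<And>f g. P f \<Longrightarrow> P g \<Longrightarrow> P (f * g)"
  shows "P (f :: 'k::field dpoly)"
proof -
  have sum: "P (sum h A)" if "finite A" "\<And>a. a \<in> A \<Longrightarrow> P (h a)" for h :: "_ \<Rightarrow> 'k dpoly" and A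
    using that by (induction A rule: finite_induct) (use const[of 0] in \<open>auto intro: add\<close>)
  have pow: "P (Poly_Mapping.single (Poly_Mapping.single v k) 1)" for v k
  proof (induction k)
    case 0
    show ?case using const[of 1] by simp
  next
    case (Suc k)
    have "Poly_Mapping.single (Poly_Mapping.single v (Suc k)) (1::'k)
        = dvar (fst v) (snd v) * Poly_Mapping.single (Poly_Mapping.single v k) 1"
      by (simp add: dvar_def mult_single single_add[symmetric])
    then show ?case by (simp add: dvar mult Suc)
  qed
  have monom_sum: "P (Poly_Mapping.single (\<Sum>v\<in>A. Poly_Mapping.single v (h v)) 1)" if "finite A" for A h
    using that
  proof (induction A rule: finite_induct)
    case empty
    show ?case using const[of 1] by simp
  next
    case (insert v A)
    have "Poly_Mapping.single (\<Sum>v\<in>insert v A. Poly_Mapping.single v (h v)) (1::'k)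
      = Poly_Mapping.single (Poly_Mapping.single v (h v)) 1
        * Poly_Mapping.single (\<Sum>v\<in>A. Poly_Mapping.single v (h v)) 1"
      using insert by (simp add: mult_single)
    then show ?case by (simp add: mult pow insert)
  qed
  have "m = (\<Sum>v\<in>Poly_Mapping.keys m. Poly_Mapping.single v (Poly_Mapping.lookup m v))"
    for m :: "(nat \<times> nat) \<Rightarrow>\<^sub>0 nat"
    by (rule poly_mapping_eqI) (auto simp: lookup_sum lookup_single when_def in_keys_iff)
  then have monom: "P (Poly_Mapping.single m 1)" for m
    using monom_sum[OF finite_keys] by metis
  have "P (Poly_Mapping.single m c)" for m c
    using mult[OF const[of c] monom[of m]] by (simp add: mult_single)
  then show ?thesis
    by (subst dpoly_expand) (intro sum finite_keys)
qed

lemma derivation_eqI: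
  assumes "derivation d" "derivation e" "\<And>i r. d (dvar i r) = e (dvar i r)"
  shows "d f = e f"
  by (induction f rule: dpoly_induct)
    (simp_all add: assms derivation_const derivation_add derivation_mult)

section \<open>Derivations with prescribed values on the variables\<close>

definition deriv_monom :: "(nat \<times> nat \<Rightarrow> 'k::field dpoly) \<Rightarrow> ((nat \<times> nat) \<Rightarrow>\<^sub>0 nat) \<Rightarrow> 'k dpoly" where
  "deriv_monom W m = (\<Sum>v \<in> Poly_Mapping.keys m.
     Poly_Mapping.single (m - Poly_Mapping.single v 1) (of_nat (Poly_Mapping.lookup m v)) * W v)"

text \<open>The vector field \<open>\<Sum>v. W v * \<partial>/\<partial>v\<close>. Both the partial
  derivatives \<open>pd\<close> and the derivation \<open>ad_subst\<close> are instances.\<close>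

definition deriv :: "(nat \<times> nat \<Rightarrow> 'k::field dpoly) \<Rightarrow> 'k dpoly \<Rightarrow> 'k dpoly" where
  "deriv W f = (\<Sum>m \<in> Poly_Mapping.keys f. scale (Poly_Mapping.lookup f m) (deriv_monom W m))"

lemma deriv_monom_superset:
  assumes "finite A" "Poly_Mapping.keys m \<subseteq> A"
  shows "deriv_monom W m = (\<Sum>v \<in> A.
     Poly_Mapping.single (m - Poly_Mapping.single v 1) (of_nat (Poly_Mapping.lookup m v)) * W v)"
  unfolding deriv_monom_def using assms by (intro sum.mono_neutral_left) (auto simp: in_keys_iff)

lemma deriv_superset:
  assumes "finite A" "Poly_Mapping.keys f \<subseteq> A"
  shows "deriv W f = (\<Sum>m \<in> A. scale (Poly_Mapping.lookup f m) (deriv_monom W m))"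
  unfolding deriv_def using assms by (intro sum.mono_neutral_left) (auto simp: in_keys_iff)

lemma deriv_single: "deriv W (Poly_Mapping.single m c) = scale c (deriv_monom W m)"
  by (cases "c = 0") (simp_all add: deriv_def)

lemma deriv_add: "deriv W (f + g) = deriv W f + deriv W g"
proof -
  let ?A = "Poly_Mapping.keys f \<union> Poly_Mapping.keys g"
  have "deriv W (f + g) = (\<Sum>m \<in> ?A. scale (Poly_Mapping.lookup (f + g) m) (deriv_monom W m))"
    by (rule deriv_superset) (auto dest: keys_add[THEN subsetD])
  also have "\<dots> = deriv W f + deriv W g"
    by (subst (1 2) deriv_superset[where A = ?A])
      (auto simp: sum.distrib[symmetric] lookup_add scale_def single_add distrib_right)
  finally show ?thesis .
qed

lemma deriv_sum: "finite A \<Longrightarrow> deriv W (sum h A) = (\<Sum>a\<in>A. deriv W (h a))"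
  by (induction A rule: finite_induct) (auto simp: deriv_add deriv_def[of W 0])

lemma deriv_monom_add:
  "deriv_monom W (a + b) =
     deriv_monom W a * Poly_Mapping.single b 1 + Poly_Mapping.single a 1 * deriv_monom W b"
proof -
  let ?A = "Poly_Mapping.keys a \<union> Poly_Mapping.keys b"
  let ?s = "\<lambda>m c v. Poly_Mapping.single (m - Poly_Mapping.single v 1)
       (of_nat (Poly_Mapping.lookup c v)) :: 'a dpoly"
  have *: "deriv_monom W m = (\<Sum>v \<in> ?A. ?s m m v * W v)" if "Poly_Mapping.keys m \<subseteq> ?A" for m
    using deriv_monom_superset[of ?A m W] that by simp
  \<comment> \<open>The case \<open>w = 0\<close> of \<open>shift_single\<close>: if
    \<open>v\<close> does not occur in \<open>a\<close>, both coefficients are \<open>0\<close>;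
    otherwise the truncated subtraction is exact and \<open>b\<close> factors out.\<close>
  have shift: "?s (a + b) a v = ?s a a v * Poly_Mapping.single b 1" for a b v
    using shift_single[of a b v 0] by simp
  have "deriv_monom W (a + b) = (\<Sum>v \<in> ?A. ?s (a + b) (a + b) v * W v)"
    by (intro *) (rule keys_add)
  also have "\<dots> = (\<Sum>v \<in> ?A. (?s (a + b) a v + ?s (b + a) b v) * W v)"
    by (simp add: lookup_add single_add add.commute)
  also have "\<dots> = (\<Sum>v \<in> ?A. ?s a a v * W v * Poly_Mapping.single b 1 + Poly_Mapping.single a 1 * (?s b b v * W v))"
    unfolding shift by (simp add: algebra_simps)
  finally show ?thesis
    by (simp add: *[of a] *[of b] sum.distrib sum_distrib_left sum_distrib_right)
qed

lemma deriv_mult: "deriv W (f * g) = deriv W f * g + f * deriv W g"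
proof -
  have single: "deriv W (Poly_Mapping.single a c * Poly_Mapping.single b d) =
     deriv W (Poly_Mapping.single a c) * Poly_Mapping.single b d
     + Poly_Mapping.single a c * deriv W (Poly_Mapping.single b d)" for a b c d
  proof -
    have c: "Poly_Mapping.single a c = Poly_Mapping.single 0 c * Poly_Mapping.single a (1::'a)"
      for a :: "(nat \<times> nat) \<Rightarrow>\<^sub>0 nat" and c
      by (simp add: mult_single)
    have cd: "Poly_Mapping.single 0 (c * d)
        = Poly_Mapping.single (0 :: (nat \<times> nat) \<Rightarrow>\<^sub>0 nat) c * Poly_Mapping.single 0 d"
      by (simp add: mult_single)
    show ?thesis
      unfolding mult_single deriv_single deriv_monom_add scale_def
      by (subst (1) c[of b d], subst (1) c[of a c]) (simp only: cd distrib_left mult_ac)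
  qed
  let ?F = "\<lambda>m. Poly_Mapping.single m (Poly_Mapping.lookup f m)"
  let ?G = "\<lambda>m. Poly_Mapping.single m (Poly_Mapping.lookup g m)"
  let ?f = "sum ?F (Poly_Mapping.keys f)" and ?g = "sum ?G (Poly_Mapping.keys g)"
  have "deriv W (?f * ?g) = deriv W ?f * ?g + ?f * deriv W ?g"
    by (simp only: sum_product deriv_sum finite_keys single sum.distrib)
  then show ?thesis by (simp only: dpoly_expand[symmetric])
qed

lemma derivation_deriv: "derivation (deriv W)"
  by (simp add: derivation_def deriv_add deriv_mult deriv_single deriv_monom_def)

lemma deriv_dvar: "deriv W (dvar i r) = W (i, r)"
  by (simp add: dvar_def deriv_single deriv_monom_def)

text \<open>The commutator with \<open>D\<close> is a derivation, and the assumption says that it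
  vanishes on every variable.\<close>

lemma deriv_D_commute:
  assumes "\<And>i r. W (i, Suc r) = D (W (i, r))"
  shows "deriv W (D f) = D (deriv W f)"
proof -
  have "deriv W (D f) - D (deriv W f) = 0"
    by (rule derivation_eqI[OF derivation_commutator[OF derivation_deriv derivation_D] derivation_zero])
      (simp add: D_dvar deriv_dvar assms)
  then show ?thesis by simp
qed


subsection \<open>Partial derivatives\<close>

definition pd :: "nat \<times> nat \<Rightarrow> 'k::field dpoly \<Rightarrow> 'k dpoly" where
  "pd v = deriv (\<lambda>u. if u = v then 1 else 0)"

lemma derivation_pd: "derivation (pd v)"
  by (simp add: pd_def derivation_deriv)

lemma pd_dvar: "pd v (dvar i r) = (if v = (i, r) then 1 else 0)"
  by (auto simp: pd_def deriv_dvar)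

lemma pd_eq_0:
  assumes "\<And>m. m \<in> Poly_Mapping.keys f \<Longrightarrow> v \<notin> Poly_Mapping.keys m"
  shows "pd v f = 0"
proof -
  have "deriv_monom (\<lambda>u. if u = v then 1 else 0) m = (0 :: 'a dpoly)" if "m \<in> Poly_Mapping.keys f" for m
    unfolding deriv_monom_def using assms[OF that] by (intro sum.neutral) auto
  then show ?thesis by (simp add: pd_def deriv_def)
qed

text \<open>Monomials containing \<open>v\<close> stay distinct when the exponent of
  \<open>v\<close> drops by one, so nothing cancels. In characteristic 0, \<open>pd v f = 0\<close>
  therefore excludes \<open>v\<close> from \<open>f\<close>.\<close>

lemma lookup_pd:
  "Poly_Mapping.lookup (pd v f) (m - Poly_Mapping.single v 1) =
     of_nat (Poly_Mapping.lookup m v) * Poly_Mapping.lookup f m"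
  if "v \<in> Poly_Mapping.keys m"
proof -
  let ?W = "\<lambda>u. if u = v then 1 else 0 :: 'a dpoly"
  have dm: "deriv_monom ?W k = Poly_Mapping.single (k - Poly_Mapping.single v 1)
      (of_nat (Poly_Mapping.lookup k v))" for k
    by (subst deriv_monom_superset[where A = "insert v (Poly_Mapping.keys k)"])
      (auto simp: if_distrib[where f = "\<lambda>x. _ * x"] cong: if_cong)
  have inj: "k = m" if "k - Poly_Mapping.single v 1 = m - Poly_Mapping.single v 1"
    and "of_nat (Poly_Mapping.lookup k v) \<noteq> (0 :: 'a)" for k
  proof (rule poly_mapping_eqI)
    fix u
    show "Poly_Mapping.lookup k u = Poly_Mapping.lookup m u"
      using arg_cong[OF that(1), of "\<lambda>x. Poly_Mapping.lookup x u"] that(2) \<open>v \<in> Poly_Mapping.keys m\<close>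
      by (cases "u = v"; cases "Poly_Mapping.lookup k v") (simp_all add: lookup_minus lookup_single_not_eq in_keys_iff)
  qed
  have "Poly_Mapping.lookup (pd v f) (m - Poly_Mapping.single v 1) =
      (\<Sum>k \<in> Poly_Mapping.keys f. if k = m then of_nat (Poly_Mapping.lookup m v) * Poly_Mapping.lookup f m else 0)"
    unfolding pd_def deriv_def lookup_sum lookup_scale dm
    by (intro sum.cong refl) (auto simp: lookup_single when_def simp del: One_nat_def dest: inj)
  also have "\<dots> = of_nat (Poly_Mapping.lookup m v) * Poly_Mapping.lookup f m"
    by (simp add: in_keys_iff)
  finally show ?thesis .
qed

text \<open>\<open>D\<close> raises the order of a variable, so no variable is sent by
  \<open>D\<close> to one of order 0.\<close>

lemma pd_D_0: "pd (i, 0) (D f) = D (pd (i, 0) f)"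
  unfolding pd_def
  by (intro deriv_D_commute) (auto simp: D_1)

text \<open>The extra term arises because \<open>D\<close> sends \<open>x_i^(r)\<close> to
  \<open>x_i^(r+1)\<close>; on variables both sides of the commutator identity are 0 or 1.\<close>

lemma pd_D_Suc: "pd (i, Suc r) (D f) = D (pd (i, Suc r) f) + pd (i, r) f"
proof -
  have "pd (i, Suc r) (D f) - D (pd (i, Suc r) f) = pd (i, r) f"
    by (rule derivation_eqI[OF derivation_commutator[OF derivation_pd derivation_D] derivation_pd])
      (simp add: D_dvar pd_dvar D_1)
  then show ?thesis by (simp add: algebra_simps)
qed

lemma pd_bounded:
  fixes f :: "'k::field dpoly"
  obtains R where "\<And>i r. r \<ge> R \<Longrightarrow> pd (i, r) f = 0"
proof -
  have "finite (snd ` (\<Union>m\<in>Poly_Mapping.keys f. Poly_Mapping.keys m))" by simp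
  then obtain R where R: "\<And>r. r \<in> snd ` (\<Union>m\<in>Poly_Mapping.keys f. Poly_Mapping.keys m) \<Longrightarrow> r < R"
    by (metis finite_nat_set_iff_bounded)
  have "pd (i, r) f = 0" if "r \<ge> R" for i r
    using R[of r] that by (intro pd_eq_0) force
  then show ?thesis by (rule that)
qed

text \<open>Since \<open>pd (i, r) f = pd (i, Suc r) (D f) - D (pd (i, Suc r) f)\<close>, vanishing propagates
  downwards from large \<open>r\<close>.\<close>

lemma pd_descent:
  assumes "\<And>r. r \<ge> k \<Longrightarrow> pd (i, Suc r) (D f) = 0" and "r \<ge> k"
  shows "pd (i, r) f = 0"
proof -
  obtain R where R: "\<And>i r. r \<ge> R \<Longrightarrow> pd (i, r) f = 0"
    using pd_bounded[of f] by blast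
  have "\<forall>r \<ge> R - j. r \<ge> k \<longrightarrow> pd (i, r) f = 0" for j
  proof (induction j)
    case (Suc j)
    have "pd (i, r) f = 0" if "r \<ge> R - Suc j" "r \<ge> k" for r
      using Suc that pd_D_Suc[of i r f] assms(1)[of r] by auto
    then show ?case by blast
  qed (use R in auto)
  from this[of R] assms(2) show ?thesis by simp
qed

text \<open>Descent down to order 0 kills every partial derivative of \<open>f\<close>, and in
  characteristic 0 a variable occurring in \<open>f\<close> would leave a nonzero one.\<close>

lemma D_eq_0_imp_const:
  fixes f :: "'k::field_char_0 dpoly"
  assumes "D f = 0" "m \<in> Poly_Mapping.keys f"
  shows "m = 0"
proof (rule ccontr)
  assume "m \<noteq> 0"
  then obtain i r where v: "(i, r) \<in> Poly_Mapping.keys m"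
    by (metis equals0I keys_eq_empty surj_pair)
  have "pd (i, r) f = 0"
    by (rule pd_descent[of 0]) (simp_all add: assms(1) derivation_0[OF derivation_pd])
  with lookup_pd[OF v, of f] v assms(2) show False
    by (simp add: in_keys_iff)
qed


subsection \<open>Support of Novikov elements\<close>

text \<open>A variable of order \<open>r\<close> weighs \<open>r - 1\<close>, so order 0 has
  negative weight and integers are used. The shift by one makes weight \<open>-1\<close> stable
  under \<open>f * D g\<close>.\<close>

definition weight :: "((nat \<times> nat) \<Rightarrow>\<^sub>0 nat) \<Rightarrow> int" where
  "weight m = (\<Sum>v \<in> Poly_Mapping.keys m. int (Poly_Mapping.lookup m v) * (int (snd v) - 1))"

text \<open>Membership in \<open>diff_alg n\<close> is carried along because the main argument also
  needs that \<open>x_0\<close> is absent from Novikov elements.\<close>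

definition isobaric :: "nat \<Rightarrow> int \<Rightarrow> 'k::field dpoly set" where
  "isobaric n w = {f \<in> diff_alg n. \<forall>m \<in> Poly_Mapping.keys f. weight m = w}"

lemma weight_superset:
  assumes "finite A" "Poly_Mapping.keys m \<subseteq> A"
  shows "weight m = (\<Sum>v \<in> A. int (Poly_Mapping.lookup m v) * (int (snd v) - 1))"
  unfolding weight_def using assms by (intro sum.mono_neutral_left) (auto simp: in_keys_iff)

lemma weight_add: "weight (a + b) = weight a + weight b"
  using keys_add[of a b]
  by (subst (1 2 3) weight_superset[where A = "Poly_Mapping.keys a \<union> Poly_Mapping.keys b"])
    (auto simp: lookup_add algebra_simps sum.distrib[symmetric])

lemma weight_0: "weight 0 = 0"
  by (simp add: weight_def)

lemma weight_single: "weight (Poly_Mapping.single v k) = int k * (int (snd v) - 1)"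
  by (cases "k = 0") (simp_all add: weight_def)

lemma weight_sum: "finite A \<Longrightarrow> weight (sum h A) = (\<Sum>a\<in>A. weight (h a))"
  by (induction A rule: finite_induct) (simp_all add: weight_0 weight_add)

lemma isobaric_add: "f \<in> isobaric n w \<Longrightarrow> g \<in> isobaric n w \<Longrightarrow> f + g \<in> isobaric n w"
  using keys_add[of f g] unfolding isobaric_def diff_alg_def by blast

lemma isobaric_0: "0 \<in> isobaric n w"
  by (simp add: isobaric_def diff_alg_def)

lemma isobaric_sum: "(\<And>a. a \<in> A \<Longrightarrow> h a \<in> isobaric n w) \<Longrightarrow> sum h A \<in> isobaric n w"
  by (induction A rule: infinite_finite_induct) (simp_all add: isobaric_0 isobaric_add)

lemma isobaric_scale: "f \<in> isobaric n w \<Longrightarrow> scale c f \<in> isobaric n w"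
  by (auto simp: isobaric_def diff_alg_def in_keys_iff)

lemma isobaric_mult:
  assumes "f \<in> isobaric n w" "g \<in> isobaric n w'"
  shows "f * g \<in> isobaric n (w + w')"
proof -
  have "Poly_Mapping.keys m \<subseteq> {1..n} \<times> UNIV \<and> weight m = w + w'"
    if m: "m \<in> Poly_Mapping.keys (f * g)" for m
  proof -
    obtain a b where "m = a + b" "a \<in> Poly_Mapping.keys f" "b \<in> Poly_Mapping.keys g"
      using m keys_mult[of f g] by blast
    moreover from this assms have "Poly_Mapping.keys a \<subseteq> {1..n} \<times> UNIV" "weight a = w"
      "Poly_Mapping.keys b \<subseteq> {1..n} \<times> UNIV" "weight b = w'"
      unfolding isobaric_def diff_alg_def by blast+
    ultimately show ?thesis
      using keys_add[of a b] by (simp add: weight_add) blast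
  qed
  then show ?thesis by (simp add: isobaric_def diff_alg_def)
qed

lemma isobaric_D:
  fixes f :: "'k::field dpoly"
  assumes "f \<in> isobaric n w"
  shows "D f \<in> isobaric n (w + 1)"
  unfolding D_def
proof (intro isobaric_sum isobaric_scale)
  fix m
  assume "m \<in> Poly_Mapping.keys f"
  with assms have m: "Poly_Mapping.keys m \<subseteq> {1..n} \<times> UNIV" "weight m = w"
    by (auto simp: isobaric_def diff_alg_def)
  have "Poly_Mapping.single (m - Poly_Mapping.single (i, r) 1 + Poly_Mapping.single (i, Suc r) 1) c
      \<in> isobaric n (w + 1)" if ir: "(i, r) \<in> Poly_Mapping.keys m" for i r and c :: 'k
  proof -
    let ?m = "m - Poly_Mapping.single (i, r) 1"
    have dec: "m = ?m + Poly_Mapping.single (i, r) 1"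
      using ir by (intro poly_mapping_eqI) (auto simp: lookup_add lookup_minus lookup_single when_def in_keys_iff)
    then have "weight m = weight ?m + (int r - 1)"
      by (metis weight_add weight_single mult_1 of_nat_1 snd_conv)
    then have "weight (?m + Poly_Mapping.single (i, Suc r) 1) = w + 1"
      using m by (simp add: weight_add weight_single)
    moreover have "Poly_Mapping.keys (?m + Poly_Mapping.single (i, Suc r) 1) \<subseteq> {1..n} \<times> UNIV"
    proof -
      have "Poly_Mapping.keys ?m \<subseteq> Poly_Mapping.keys m"
        by (auto simp: in_keys_iff lookup_minus)
      moreover have "Poly_Mapping.keys (Poly_Mapping.single (i, Suc r) (1 :: nat)) \<subseteq> {1..n} \<times> UNIV"
        using m(1) ir by auto
      ultimately show ?thesis
        using m(1) keys_add[of ?m "Poly_Mapping.single (i, Suc r) 1"] by blast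
    qed
    ultimately show ?thesis by (simp add: isobaric_def diff_alg_def)
  qed
  then show "(D_monom m :: 'k dpoly) \<in> isobaric n (w + 1)"
    unfolding D_monom_def case_prod_unfold by (intro isobaric_sum) (metis prod.collapse)
qed

text \<open>Generators weigh \<open>-1\<close>, and \<open>f * D g\<close> weighs
  \<open>-1 + (-1 + 1) = -1\<close>.\<close>

lemma free_Novikov_isobaric: "free_Novikov n \<subseteq> isobaric n (- 1)"
proof
  fix f :: "'a dpoly"
  assume "f \<in> free_Novikov n"
  then show "f \<in> isobaric n (- 1)"
    unfolding free_Novikov_def
  proof (induction rule: gen_subalgebra.induct)
    case (gen f)
    then show ?case by (auto simp: gens_def dvar_def isobaric_def diff_alg_def weight_single)
  next
    case (mul f g)
    show ?case
      using isobaric_mult[OF mul.IH(1) isobaric_D[OF mul.IH(2)]] by (simp add: nov_prod_def)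
  qed (simp_all add: isobaric_0 isobaric_add isobaric_scale)
qed

section \<open>Multilinear monomials of weight \<open>-1\<close>\<close>

lemma weight_dmonom:
  "weight (dmonom n \<alpha>) = int (\<Sum>i = 1..n. Poly_Mapping.lookup \<alpha> i) - int n"
  by (simp add: dmonom_def weight_sum weight_single sum_subtractf)

text \<open>Natural exponents with sum 1 over the variables of index \<open>i\<close> leave a single
  such variable, with exponent 1; its order becomes the \<open>i\<close>-th entry of
  \<open>\<alpha>\<close>.\<close>

lemma multilinear_monomialE:
  assumes m: "Poly_Mapping.keys m \<subseteq> {1..n} \<times> UNIV"
    and lin: "\<And>i. i \<in> {1..n} \<Longrightarrow>
      (\<Sum>v \<in> {v \<in> Poly_Mapping.keys m. fst v = i}. Poly_Mapping.lookup m v) = 1"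
  obtains \<alpha> where "Poly_Mapping.keys \<alpha> \<subseteq> {1..n}" "m = dmonom n \<alpha>"
proof -
  have "\<exists>r. \<forall>s. Poly_Mapping.lookup m (i, s) = (if s = r then 1 else 0)" if i: "i \<in> {1..n}" for i
  proof -
    let ?A = "{v \<in> Poly_Mapping.keys m. fst v = i}"
    obtain v where v: "v \<in> ?A" "Poly_Mapping.lookup m v = 1" "\<And>u. u \<in> ?A \<Longrightarrow> u \<noteq> v \<Longrightarrow> Poly_Mapping.lookup m u = 0"
      using lin[OF i] by (subst (asm) sum_eq_1_iff) auto
    obtain r where r: "v = (i, r)" using v(1) by (cases v) simp
    have "Poly_Mapping.lookup m (i, s) = (if s = r then 1 else 0)" for s
      using v(2) v(3)[of "(i, s)"] r by (cases "(i, s) \<in> Poly_Mapping.keys m") (auto simp: in_keys_iff)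
    then show ?thesis by blast
  qed
  then obtain \<rho> where \<rho>: "\<And>i s. i \<in> {1..n} \<Longrightarrow> Poly_Mapping.lookup m (i, s) = (if s = \<rho> i then 1 else 0)"
    by metis
  define \<alpha> where "\<alpha> = (\<Sum>i = 1..n. Poly_Mapping.single i (\<rho> i))"
  have \<alpha>: "Poly_Mapping.lookup \<alpha> i = (if i \<in> {1..n} then \<rho> i else 0)" for i
    by (simp add: \<alpha>_def lookup_sum lookup_single when_def)
  show ?thesis
  proof
    show "Poly_Mapping.keys \<alpha> \<subseteq> {1..n}"
      using \<alpha> by (auto simp: in_keys_iff split: if_splits)
    show "m = dmonom n \<alpha>"
    proof (rule poly_mapping_eqI)
      fix v :: "nat \<times> nat"
      obtain i s where v: "v = (i, s)" by (cases v)
      have "i \<notin> {1..n} \<Longrightarrow> Poly_Mapping.lookup m (i, s) = 0"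
        using m by (auto simp: in_keys_iff)
      then show "Poly_Mapping.lookup m v = Poly_Mapping.lookup (dmonom n \<alpha>) v"
        unfolding v lookup_dmonom using \<rho>[of i s] \<alpha>[of i] by (cases "i \<in> {1..n}") auto
    qed
  qed
qed

text \<open>Since \<open>dmonom n \<alpha>\<close> weighs the sum of the entries of
  \<open>\<alpha>\<close> minus \<open>n\<close>, weight \<open>-1\<close> forces that sum to be
  \<open>n - 1\<close>.\<close>

lemma keys_Nov:
  assumes "f \<in> Nov n" "n \<ge> 1"
  shows "Poly_Mapping.keys f \<subseteq> dmonom n ` exponents n (n - 1)"
proof
  fix m
  assume m: "m \<in> Poly_Mapping.keys f"
  have "f \<in> isobaric n (- 1)"
    using assms free_Novikov_isobaric by (auto simp: Nov_def)
  then have k: "Poly_Mapping.keys m \<subseteq> {1..n} \<times> UNIV" and w: "weight m = - 1"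
    using m by (auto simp: isobaric_def diff_alg_def)
  have "\<And>i. i \<in> {1..n} \<Longrightarrow>
      (\<Sum>v \<in> {v \<in> Poly_Mapping.keys m. fst v = i}. Poly_Mapping.lookup m v) = 1"
    using assms(1) m by (auto simp: Nov_def multilinear_def)
  with k obtain \<alpha> where \<alpha>: "Poly_Mapping.keys \<alpha> \<subseteq> {1..n}" "m = dmonom n \<alpha>"
    by (rule multilinear_monomialE)
  have "(\<Sum>i = 1..n. Poly_Mapping.lookup \<alpha> i) = n - 1"
    using w assms(2) unfolding \<alpha>(2) weight_dmonom by linarith
  with \<alpha> show "m \<in> dmonom n ` exponents n (n - 1)"
    by (auto simp: exponents_def)
qed


subsection \<open>Symbols of total derivatives\<close>

lemma poly_symbol_add: "poly_symbol n (f + g) = poly_symbol n f + poly_symbol n g"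
  by (rule poly_mapping_eqI) (simp add: lookup_poly_symbol lookup_add)

lemma poly_symbol_0: "poly_symbol n 0 = 0"
  by (rule poly_mapping_eqI) (simp add: lookup_poly_symbol)

lemma poly_symbol_sum: "poly_symbol n (sum h A) = (\<Sum>a\<in>A. poly_symbol n (h a))"
  by (induction A rule: infinite_finite_induct) (simp_all add: poly_symbol_0 poly_symbol_add)

text \<open>On such supports the symbol records every coefficient. The hypotheses concern supports
  and not membership in \<open>Nov n\<close>, so that one side can be a total derivative.\<close>

lemma poly_symbol_inject:
  assumes "Poly_Mapping.keys f \<subseteq> dmonom n ` exponents n (n - 1)"
    and "Poly_Mapping.keys g \<subseteq> dmonom n ` exponents n (n - 1)"
    and "poly_symbol n f = poly_symbol n g"
  shows "f = g"
proof (rule poly_mapping_eqI)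
  fix m
  show "Poly_Mapping.lookup f m = Poly_Mapping.lookup g m"
  proof (cases "m \<in> dmonom n ` exponents n (n - 1)")
    case True
    then show ?thesis
      using assms(3) by (metis imageE lookup_poly_symbol)
  next
    case False
    then show ?thesis using assms(1,2) by (metis in_keys_iff subsetD)
  qed
qed

text \<open>Every variable of \<open>dmonom n \<alpha>\<close> has exponent 1, so the Leibniz
  coefficients are 1. On exponent vectors this is multiplication of \<open>t^\<alpha>\<close> by
  \<open>sigma n\<close>.\<close>

lemma D_monom_dmonom:
  "D_monom (dmonom n \<alpha>) =
     (\<Sum>i = 1..n. Poly_Mapping.single (dmonom n (\<alpha> + Poly_Mapping.single i 1)) (1 :: 'k::field))"
proof -
  let ?v = "\<lambda>i. (i, Poly_Mapping.lookup \<alpha> i)"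
  have keys: "Poly_Mapping.keys (dmonom n \<alpha>) = ?v ` {1..n}"
    by (auto simp: in_keys_iff lookup_dmonom split: if_splits)
  have shift: "dmonom n \<alpha> - Poly_Mapping.single (?v i) 1 + Poly_Mapping.single (i, Suc (Poly_Mapping.lookup \<alpha> i)) 1
      = dmonom n (\<alpha> + Poly_Mapping.single i 1)" if "i \<in> {1..n}" for i
  proof (rule poly_mapping_eqI)
    fix v :: "nat \<times> nat"
    show "Poly_Mapping.lookup (dmonom n \<alpha> - Poly_Mapping.single (?v i) 1
        + Poly_Mapping.single (i, Suc (Poly_Mapping.lookup \<alpha> i)) 1) v
      = Poly_Mapping.lookup (dmonom n (\<alpha> + Poly_Mapping.single i 1)) v"
      using that
      by (cases v) (auto simp: lookup_dmonom lookup_add lookup_minus lookup_single when_def)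
  qed
  show ?thesis
    unfolding D_monom_def keys
    by (subst sum.reindex) (auto simp: inj_on_def shift lookup_dmonom simp del: One_nat_def intro!: sum.cong)
qed

lemma homogeneous_eq_sum:
  assumes "q \<in> homogeneous n d"
  shows "q = (\<Sum>\<beta> \<in> exponents n d. Poly_Mapping.single \<beta> (Poly_Mapping.lookup q \<beta>))"
proof (rule poly_mapping_eqI)
  fix \<alpha>
  have "\<alpha> \<notin> exponents n d \<Longrightarrow> Poly_Mapping.lookup q \<alpha> = 0"
    using assms by (auto simp: homogeneous_def in_keys_iff)
  then show "Poly_Mapping.lookup q \<alpha> = Poly_Mapping.lookup
      (\<Sum>\<beta> \<in> exponents n d. Poly_Mapping.single \<beta> (Poly_Mapping.lookup q \<beta>)) \<alpha>"
    by (auto simp: lookup_sum lookup_single when_def finite_exponents)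
qed

lemma exponents_Suc:
  assumes "\<beta> \<in> exponents n d" "i \<in> {1..n}"
  shows "\<beta> + Poly_Mapping.single i 1 \<in> exponents n (Suc d)"
proof -
  have "Poly_Mapping.keys (\<beta> + Poly_Mapping.single i 1) \<subseteq> {1..n}"
    using assms keys_add[of \<beta> "Poly_Mapping.single i 1"] by (auto simp: exponents_def)
  moreover have "(\<Sum>j = 1..n. Poly_Mapping.lookup (Poly_Mapping.single i 1) j) = (1 :: nat)"
    using assms(2) by (simp add: lookup_single when_def)
  ultimately show ?thesis
    using assms(1) by (simp add: exponents_def lookup_add sum.distrib)
qed

text \<open>The witness \<open>g\<close> is \<open>q\<close> with each \<open>t^\<beta>\<close>
  replaced by \<open>dmonom n \<beta>\<close>. It has weight \<open>-2\<close>, one below the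
  Novikov elements, and \<open>D\<close> lifts it to weight \<open>-1\<close>.\<close>

lemma sigma_mult_symbol:
  assumes "n \<ge> 2" "q \<in> homogeneous n (n - 2)"
  obtains g where "poly_symbol n (D g) = sigma n * q"
    "Poly_Mapping.keys (D g) \<subseteq> dmonom n ` exponents n (n - 1)"
proof -
  let ?E = "exponents n (n - 2)"
  let ?c = "Poly_Mapping.lookup q"
  let ?e = "\<lambda>\<beta> i. \<beta> + Poly_Mapping.single i 1"
  define g where "g = (\<Sum>\<beta> \<in> ?E. Poly_Mapping.single (dmonom n \<beta>) (?c \<beta>))"
  have n: "Suc (n - 2) = n - 1" using assms(1) by simp
  have e: "?e \<beta> i \<in> exponents n (n - 1)" if "\<beta> \<in> ?E" "i \<in> {1..n}" for \<beta> i
    using exponents_Suc[OF that] by (simp add: n)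
  have Dg: "D g = (\<Sum>\<beta> \<in> ?E. \<Sum>i = 1..n. Poly_Mapping.single (dmonom n (?e \<beta> i)) (?c \<beta>))"
    unfolding g_def D_sum D_single D_monom_dmonom scale_def sum_distrib_left mult_single by simp
  show ?thesis
  proof
    show "poly_symbol n (D g) = sigma n * q"
    proof -
      have "poly_symbol n (D g) = (\<Sum>\<beta> \<in> ?E. \<Sum>i = 1..n. Poly_Mapping.single (?e \<beta> i) (?c \<beta>))"
        unfolding Dg poly_symbol_sum by (intro sum.cong refl poly_symbol_dmonom e)
      also have "\<dots> = (\<Sum>i = 1..n. \<Sum>\<beta> \<in> ?E. tvar i * Poly_Mapping.single \<beta> (?c \<beta>))"
        by (subst sum.swap) (simp add: tvar_def mult_single add.commute)
      also have "\<dots> = sigma n * q"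
        by (subst (2) homogeneous_eq_sum[OF assms(2)]) (simp add: sigma_def sum_product)
      finally show ?thesis .
    qed
    show "Poly_Mapping.keys (D g) \<subseteq> dmonom n ` exponents n (n - 1)"
    proof
      fix m
      assume "m \<in> Poly_Mapping.keys (D g)"
      then have "Poly_Mapping.lookup (D g) m \<noteq> 0" by (simp add: in_keys_iff)
      then obtain \<beta> i where "\<beta> \<in> ?E" "i \<in> {1..n}" "m = dmonom n (?e \<beta> i)"
        unfolding Dg lookup_sum by (metis (no_types, lifting) lookup_single_not_eq sum.not_neutral_contains_not_neutral)
      with e show "m \<in> dmonom n ` exponents n (n - 1)" by blast
    qed
  qed
qed


subsection \<open>Lie elements and total derivatives\<close>

text \<open>The derivation \<open>\<delta>\<close>: commuting with \<open>D\<close> forces the value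
  on \<open>x_i^(r)\<close> to be the \<open>r\<close>-th derivative of the value on
  \<open>x_i\<close>.\<close>

definition ad_subst :: "'k::field dpoly \<Rightarrow> 'k dpoly \<Rightarrow> 'k dpoly" where
  "ad_subst v = deriv (\<lambda>(i, r). (D ^^ r) (nov_comm v (dvar i 0)))"

lemma derivation_ad_subst: "derivation (ad_subst v)"
  by (simp add: ad_subst_def derivation_deriv)

lemma ad_subst_D: "ad_subst v (D f) = D (ad_subst v f)"
  unfolding ad_subst_def by (rule deriv_D_commute) simp

text \<open>Both maps are derivations of the bracket and agree on generators:
  \<open>ad_subst v\<close> because it is a derivation of the product commuting with
  \<open>D\<close>, \<open>nov_comm v\<close> by the Jacobi identity.\<close>

lemma ad_subst_Lie:
  assumes "f \<in> Lie_elements n"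
  shows "ad_subst v f = nov_comm v f"
  using assms unfolding Lie_elements_def
proof (induction rule: gen_subalgebra.induct)
  case (gen f)
  then show ?case by (auto simp: gens_def ad_subst_def deriv_dvar)
next
  case zero
  show ?case by (simp add: derivation_0[OF derivation_ad_subst] nov_comm_def nov_prod_def)
next
  case (add f g)
  then show ?case
    by (simp add: derivation_add[OF derivation_ad_subst] nov_comm_def nov_prod_def D_add algebra_simps)
next
  case (scale f c)
  then show ?case
    by (simp add: derivation_scale[OF derivation_ad_subst] nov_comm_def nov_prod_def D_scale)
      (simp add: scale_def algebra_simps)
next
  case (mul f g)
  have "ad_subst v (nov_comm f g) = nov_comm (nov_comm v f) g + nov_comm f (nov_comm v g)"
    unfolding mul.IH[symmetric]
    by (simp add: nov_comm_def nov_prod_def derivation_minus[OF derivation_ad_subst]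
        derivation_mult[OF derivation_ad_subst] ad_subst_D algebra_simps)
  \<comment> \<open>The Jacobi identity, verified by expanding all brackets with the Leibniz
    rule.\<close>
  also have "\<dots> = nov_comm v (nov_comm f g)"
    by (simp add: nov_comm_def nov_prod_def D_mult derivation_minus[OF derivation_D] algebra_simps)
  finally show ?case .
qed

lemma Lie_total_derivative_const:
  fixes f :: "'k::field_char_0 dpoly"
  assumes "f \<in> Lie_elements n" "f = D g"
  shows "D f = 0"
proof -
  \<comment> \<open>Index 0 lies outside \<open>{1..n}\<close>, so \<open>x_0\<close> is new for
    \<open>f\<close> and \<open>D f\<close>; it may occur in \<open>g\<close>, which is
    arbitrary.\<close>
  let ?v = "dvar 0 0 :: 'k dpoly"
  define H where "H = ad_subst ?v g"
  have DH: "D H = ?v * D f - f * dvar 0 (Suc 0)"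
    using ad_subst_Lie[OF assms(1), of ?v] assms(2) ad_subst_D[of ?v g]
    by (simp add: H_def nov_comm_def nov_prod_def D_dvar)
  have free: "pd (0, r) h = 0" if "h \<in> isobaric n w" for r w and h :: "'k dpoly"
    using that by (intro pd_eq_0) (force simp: isobaric_def diff_alg_def)
  have "f \<in> isobaric n (- 1)"
    using assms(1) Lie_elements_subset free_Novikov_isobaric by blast
  then have pf: "pd (0, r) f = 0" "pd (0, r) (D f) = 0" for r
    using free isobaric_D by blast+
  have pDH: "pd (0, r) (D H) = (if r = 0 then D f else 0) - (if r = Suc 0 then f else 0)" for r
    by (simp add: DH derivation_minus[OF derivation_pd] derivation_mult[OF derivation_pd] pf pd_dvar)
  \<comment> \<open>\<open>D H\<close> contains \<open>x_0\<close> only in orders 0 and 1, so its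
    partial derivatives in orders from 2 on vanish and the descent reaches order 1.\<close>
  have "pd (0, Suc 0) H = 0"
    by (rule pd_descent[of 1]) (simp_all add: pDH)
  \<comment> \<open>Order 1: the derivative of \<open>D H\<close> is \<open>- f\<close>, and the
    commutator term of \<open>pd_D_Suc\<close> is all that remains on the other side.\<close>
  then have "pd (0, 0) H = - f"
    using pd_D_Suc[of 0 0 H] pDH[of 1] by simp
  \<comment> \<open>Order 0: here the derivative of \<open>D H\<close> is \<open>D f\<close>, while
    \<open>pd_D_0\<close> gives \<open>D (- f)\<close>.\<close>
  then have "D f = - D f"
    using pd_D_0[of 0 H] pDH[of 0] derivation_minus[OF derivation_D, of 0 f] by simp
  then have "Poly_Mapping.lookup (D f) m = - Poly_Mapping.lookup (D f) m" for m
    by (metis lookup_uminus)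
  then show ?thesis by (intro poly_mapping_eqI) simp
qed

text \<open>A constant can only contain the monomial of weight 0, but \<open>f\<close> has weight
  \<open>-1\<close>. With \<open>g\<close> arbitrary, this covers both the \<open>D g\<close> built
  from a symbol and \<open>g\<close> in \<open>diff_alg n\<close>.\<close>

lemma Lie_not_total_derivative:
  fixes f :: "'k::field_char_0 dpoly"
  assumes "f \<in> Lie_elements n" "f = D g"
  shows "f = 0"
proof (rule ccontr)
  assume "f \<noteq> 0"
  then obtain m where m: "m \<in> Poly_Mapping.keys f"
    by (metis ex_in_conv keys_eq_empty)
  have "m = 0"
    using D_eq_0_imp_const[OF Lie_total_derivative_const[OF assms] m] .
  moreover have "weight m = - 1"
    using m assms(1) Lie_elements_subset free_Novikov_isobaric unfolding isobaric_def by blast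
  ultimately show False by (simp add: weight_0)
qed

theorem proposition7p3:
  fixes n :: nat
  assumes "n \<ge> 2"
  shows "(Lie_symbols n :: 'k::field_char_0 mpoly set) \<inter> {sigma n * q | q. q \<in> homogeneous n (n - 2)} = {0}
    \<and> (\<forall>f :: 'k dpoly. f \<in> Nov n \<and> f \<in> Lie_elements n \<and> f \<noteq> 0
          \<longrightarrow> \<not> (\<exists>g \<in> diff_alg n. f = D g))"
proof (intro conjI equalityI subsetI)
  fix p :: "'k mpoly"
  assume "p \<in> Lie_symbols n \<inter> {sigma n * q | q. q \<in> homogeneous n (n - 2)}"
  then obtain f q where f: "f \<in> Nov n" "f \<in> Lie_elements n" "p = poly_symbol n f"
    and q: "q \<in> homogeneous n (n - 2)" "p = sigma n * q"
    unfolding Lie_symbols_def by blast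
  \<comment> \<open>The symbol \<open>sigma n * q\<close> is realised by a total derivative
    supported where symbols are injective, which turns the equality of symbols into
    \<open>f = D g\<close>.\<close>
  obtain g where "poly_symbol n (D g) = sigma n * q"
    "Poly_Mapping.keys (D g) \<subseteq> dmonom n ` exponents n (n - 1)"
    using sigma_mult_symbol[OF assms q(1)] by blast
  moreover have "Poly_Mapping.keys f \<subseteq> dmonom n ` exponents n (n - 1)"
    using keys_Nov[OF f(1)] assms by simp
  ultimately have "f = D g"
    using f(3) q(2) by (intro poly_symbol_inject[of f n "D g"]) simp_all
  then have "f = 0"
    using Lie_not_total_derivative f(2) by blast
  then show "p \<in> {0}" by (simp add: f(3) poly_symbol_0)
next
  fix p :: "'k mpoly"
  assume "p \<in> {0}"
  have "(0 :: 'k dpoly) \<in> Nov n \<inter> Lie_elements n"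
    by (simp add: Nov_def free_Novikov_def Lie_elements_def multilinear_def gen_subalgebra.zero)
  then have "p \<in> Lie_symbols n"
    unfolding Lie_symbols_def using \<open>p \<in> {0}\<close> poly_symbol_0 by (metis image_eqI singletonD)
  moreover have "0 \<in> homogeneous n (n - 2)" by (simp add: homogeneous_def)
  ultimately show "p \<in> Lie_symbols n \<inter> {sigma n * q | q. q \<in> homogeneous n (n - 2)}"
    using \<open>p \<in> {0}\<close> by (auto intro!: exI[of _ 0])
next
  show "\<forall>f :: 'k dpoly. f \<in> Nov n \<and> f \<in> Lie_elements n \<and> f \<noteq> 0 \<longrightarrow> \<not> (\<exists>g \<in> diff_alg n. f = D g)"
    using Lie_not_total_derivative by blast
qed

end
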